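(* Let $s\ge 1$ be an integer and let $\bar{x}\in\mathbb{R}^n$ be an $s$-sparse vector. Let $A\in\mathbb{R}^{m\times n}$, let $\tau\ge 0$, and let $b=A\bar{x}+e\in\mathbb{R}^m$ with $\|e\|_2\le\tau$. Let $\delta_{3s}$ and $\delta_{4s}$ be the $3s$- and $4s$-restricted isometry constants of $A$, respectively. Let $\alpha>0$ and let $x^{\rm opt}$ be a minimizer of the springback-penalized problem $$\min_{x\in\mathbb{R}^n}\ \|x\|_1-\frac{\alpha}{2}\|x\|_2^2\quad\text{s.t.}\quad \|Ax-b\|_2\le\tau .$$ Suppose that $\delta_{3s}<3(1-\delta_{4s})-1$ and that $$\alpha\le\frac{\sqrt{1-\delta_{4s}}\sqrt{3s}-\sqrt{1+\delta_{3s}}\sqrt{s}}{(\sqrt{1-\delta_{4s}}+\sqrt{1+\delta_{3s}})\,\|x^{\rm opt}\|_{2}} .$$ Then $x^{\rm opt}=\bar{x}$ when $\tau=0$; and when $\tau\ge 0$, $$\|x^{\rm opt}-\bar{x}\|_2\le \frac{\sqrt{2}}{\sqrt{D_1}}\sqrt{\tau},\qquad\text{where}\quad D_1=\frac{\alpha}{2}\,\frac{\sqrt{1-\delta_{4s}}+\sqrt{1+\delta_{3s}}}{\sqrt{3s}+\sqrt{s}} .$$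
   Context: A vector $x\in\mathbb{R}^n$ is $s$-sparse if it has at most $s$ nonzero entries. For $A\in\mathbb{R}^{m\times n}$ and an index set $T\subset\{1,\dots,n\}$, $A_T\in\mathbb{R}^{m\times|T|}$ denotes the submatrix of $A$ with columns indexed by $T$. For a positive integer $k$, the $k$-restricted isometry constant of $A$ is the smallest $\delta_k\in(0,1)$ such that $(1-\delta_k)\|x\|_2^2\le\|A_Tx\|_2^2\le(1+\delta_k)\|x\|_2^2$ for all $T\subset\{1,\dots,n\}$ with $|T|\le k$ and all $x\in\mathbb{R}^{|T|}$; the existence of such constants for $k=3s$ and $k=4s$ is presupposed. Here $\|x\|_1=\sum_i|x_i|$ and $\|\cdot\|_2$ is the Euclidean norm. A minimizer means a global minimizer over the feasible set; its existence is presupposed. *)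

theory Defs
  imports "HOL-Analysis.Analysis"
begin

definition sparse_vec :: "nat \<Rightarrow> real ^ 'n \<Rightarrow> bool" where
  "sparse_vec s x \<longleftrightarrow> card {i. x $ i \<noteq> 0} \<le> s"

definition l1_norm :: "real ^ 'n \<Rightarrow> real" where
  "l1_norm x = (\<Sum>i\<in>UNIV. \<bar>x $ i\<bar>)"

text \<open>The product \<open>A\<^sub>T x\<close> of the column submatrix \<open>A\<^sub>T\<close> with a vector \<open>x\<close> indexed by \<open>T\<close>.
  Such a vector is represented by a function of which only the values on \<open>T\<close> matter; its
  Euclidean norm is \<open>L2_set x T\<close>.\<close>

definition submatrix_mult :: "real ^ 'n ^ 'm \<Rightarrow> 'n set \<Rightarrow> ('n \<Rightarrow> real) \<Rightarrow> real ^ 'm" where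
  "submatrix_mult A T x = (\<Sum>j\<in>T. x j *\<^sub>R column j A)"

definition restricted_isometry :: "real ^ 'n ^ 'm \<Rightarrow> nat \<Rightarrow> real \<Rightarrow> bool" where
  "restricted_isometry A k \<delta> \<longleftrightarrow>
     (\<forall>T x. card T \<le> k \<longrightarrow>
        (1 - \<delta>) * (L2_set x T)\<^sup>2 \<le> (norm (submatrix_mult A T x))\<^sup>2 \<and>
        (norm (submatrix_mult A T x))\<^sup>2 \<le> (1 + \<delta>) * (L2_set x T)\<^sup>2)"

text \<open>A relation rather than a function of \<open>A\<close> and \<open>k\<close>, because a smallest such \<open>\<delta>\<close> in the open
  interval need not exist.\<close>

definition is_RIC :: "real ^ 'n ^ 'm \<Rightarrow> nat \<Rightarrow> real \<Rightarrow> bool" where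
  "is_RIC A k \<delta> \<longleftrightarrow>
     \<delta> \<in> {0<..<1} \<and> restricted_isometry A k \<delta> \<and>
     (\<forall>\<delta>'\<in>{0<..<1}. restricted_isometry A k \<delta>' \<longrightarrow> \<delta> \<le> \<delta>')"

definition springback :: "real \<Rightarrow> real ^ 'n \<Rightarrow> real" where
  "springback \<alpha> x = l1_norm x - \<alpha> / 2 * (norm x)\<^sup>2"

end

theory Submission
  imports Defs
begin

text \<open>Write \<open>h = xopt - xbar\<close> and \<open>T0\<close> for the support of \<open>xbar\<close>. Comparing the objective at
  \<open>xopt\<close> and \<open>xbar\<close> gives the cone-type inequality
  \<open>\<parallel>h\<parallel>\<^sub>1 off T0 \<le> \<parallel>h\<parallel>\<^sub>1 on T0 + B\<close> with \<open>B = \<alpha> \<parallel>xopt\<parallel> \<parallel>h\<parallel> - \<alpha>/2 \<parallel>h\<parallel>\<^sup>2\<close>.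
  Let \<open>T1\<close> consist of the \<open>3s\<close> largest entries of \<open>h\<close> off \<open>T0\<close>. Cutting the remaining entries into
  blocks of length \<open>3s\<close> in decreasing order, both \<open>\<parallel>h\<parallel>\<close> and \<open>\<parallel>A h\<parallel>\<close> restricted to them are
  controlled by \<open>\<parallel>h\<parallel>\<^sub>1\<close> off \<open>T0\<close> divided by \<open>sqrt (3s)\<close>. Eliminating the norm of \<open>h\<close> on
  \<open>T0 \<union> T1\<close> from the resulting bounds and from \<open>\<parallel>A h\<parallel> \<le> 2\<tau>\<close> leaves a quadratic inequality in
  \<open>\<parallel>h\<parallel>\<close> whose linear coefficient is nonnegative by the bound on \<open>\<alpha>\<close>.\<close>

section \<open>Largest entries and elementary norm estimates\<close>

lemma exists_top_subset:
  fixes f :: "'a \<Rightarrow> real"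
  assumes "finite S"
  shows "\<exists>T\<subseteq>S. card T = min k (card S) \<and> (\<forall>i\<in>T. \<forall>j\<in>S - T. f j \<le> f i)"
proof (induction k)
  case 0
  show ?case by (rule exI[of _ "{}"]) auto
next
  case (Suc k)
  then obtain T where T: "T \<subseteq> S" "card T = min k (card S)"
    and top: "\<forall>i\<in>T. \<forall>j\<in>S - T. f j \<le> f i" by blast
  have fT: "finite T" using T assms finite_subset by blast
  show ?case
  proof (cases "S - T = {}")
    case True
    then have "T = S" using T by blast
    then show ?thesis using T by (intro exI[of _ S]) auto
  next
    case False
    have "finite (f ` (S - T))" "f ` (S - T) \<noteq> {}" using False assms by auto
    then obtain m where m: "m \<in> S - T" "\<And>j. j \<in> S - T \<Longrightarrow> f j \<le> f m"
      using Max_in[of "f ` (S - T)"] Max_ge[of "f ` (S - T)"] by (metis imageE imageI)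
    have "card T < card S"
      using T m assms by (metis Diff_iff psubsetI psubset_card_mono)
    then have "card (insert m T) = min (Suc k) (card S)" using T m fT by auto
    then show ?thesis
      using T m top by (intro exI[of _ "insert m T"]) auto
  qed
qed

lemma L2_set_le_sqrt_card_bound:
  fixes f :: "'a \<Rightarrow> real"
  assumes "\<And>i. i \<in> T \<Longrightarrow> \<bar>f i\<bar> \<le> M" "card T \<le> k" "M \<ge> 0"
  shows "L2_set f T \<le> sqrt (real k) * M"
proof -
  have "(\<Sum>i\<in>T. (f i)\<^sup>2) \<le> (\<Sum>i\<in>T. M\<^sup>2)"
    using assms by (intro sum_mono) (simp add: abs_le_square_iff[symmetric])
  also have "\<dots> \<le> real k * M\<^sup>2" using assms by (simp add: mult_right_mono)
  finally have "L2_set f T \<le> sqrt (real k * M\<^sup>2)" unfolding L2_set_def by simp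
  then show ?thesis using assms by (simp add: real_sqrt_mult)
qed

lemma L2_set_union_le:
  assumes "finite S" "finite T" "S \<inter> T = {}"
  shows "L2_set f (S \<union> T) \<le> L2_set f S + L2_set f T"
  unfolding L2_set_def by (simp add: sum.union_disjoint assms sqrt_add_le_add_sqrt sum_nonneg)

lemma sum_abs_le_sqrt_mult_L2_set:
  fixes f :: "'a \<Rightarrow> real"
  assumes "card T \<le> k"
  shows "(\<Sum>i\<in>T. \<bar>f i\<bar>) \<le> sqrt (real k) * L2_set f T"
proof -
  have "(\<Sum>i\<in>T. \<bar>f i\<bar>) \<le> L2_set (\<lambda>i. 1) T * L2_set f T"
    using L2_set_mult_ineq[of "\<lambda>i. 1" f T] by simp
  also have "\<dots> \<le> sqrt (real k) * L2_set f T"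
    using assms by (intro mult_right_mono) (auto simp: L2_set_def sum_nonneg)
  finally show ?thesis .
qed

section \<open>Block decomposition of a tail\<close>

text \<open>\<open>N\<close> abstracts both the norm of \<open>h\<close> and the norm of \<open>A h\<close> restricted to an index set.\<close>

locale block_bounded =
  fixes N :: "'a set \<Rightarrow> real" and h :: "'a \<Rightarrow> real" and k :: nat and C :: real
  assumes subadd: "finite S \<Longrightarrow> finite T \<Longrightarrow> S \<inter> T = {} \<Longrightarrow> N (S \<union> T) \<le> N S + N T"
    and bounded: "finite T \<Longrightarrow> card T \<le> k \<Longrightarrow> N T \<le> C * L2_set h T"
    and C_nonneg: "C \<ge> 0"
    and k_pos: "k \<ge> 1"
begin

lemma bounded_max:
  assumes "finite T" "card T \<le> k" "M \<ge> 0" "\<And>i. i \<in> T \<Longrightarrow> \<bar>h i\<bar> \<le> M"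
  shows "N T \<le> C * (sqrt (real k) * M)"
proof -
  have "L2_set h T \<le> sqrt (real k) * M" using assms by (intro L2_set_le_sqrt_card_bound) auto
  then show ?thesis using bounded[OF assms(1,2)] mult_left_mono[OF _ C_nonneg] order_trans by blast
qed

lemma tail_entry_le:
  assumes "card T = k" "\<forall>i\<in>T. x \<le> \<bar>h i\<bar>"
  shows "x \<le> (\<Sum>i\<in>T. \<bar>h i\<bar>) / real k"
proof -
  have "real k * x \<le> (\<Sum>i\<in>T. \<bar>h i\<bar>)"
    using sum_mono[of T "\<lambda>_. x" "\<lambda>i. \<bar>h i\<bar>"] assms by simp
  then show ?thesis using k_pos by (simp add: field_simps)
qed

text \<open>Peel off the \<open>k\<close> largest entries. Their block costs at most
  \<open>C * (sqrt (real k) * M)\<close>, and their mean bounds every remaining entry, so it serves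
  as the next \<open>M\<close>. Each later block is thus charged to the l1 mass of the block before
  it.\<close>

lemma sum_bound:
  assumes "finite S" "M \<ge> 0" "\<And>i. i \<in> S \<Longrightarrow> \<bar>h i\<bar> \<le> M"
  shows "N S \<le> C * (sqrt (real k) * M + (\<Sum>i\<in>S. \<bar>h i\<bar>) / sqrt (real k))"
  using assms
proof (induction "card S" arbitrary: S M rule: less_induct)
  case less
  show ?case
  proof (cases "card S \<le> k")
    case True
    have "N S \<le> C * (sqrt (real k) * M)" using bounded_max less.prems True by blast
    also have "\<dots> \<le> C * (sqrt (real k) * M + (\<Sum>i\<in>S. \<bar>h i\<bar>) / sqrt (real k))"
      using C_nonneg by (intro mult_left_mono) (auto simp: sum_nonneg)
    finally show ?thesis .
  next
    case False
    obtain T where T: "T \<subseteq> S" "card T = min k (card S)"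
      and top: "\<forall>i\<in>T. \<forall>j\<in>S - T. \<bar>h j\<bar> \<le> \<bar>h i\<bar>"
      using exists_top_subset[OF less.prems(1), of k "\<lambda>i. \<bar>h i\<bar>"] by blast
    have cT: "card T = k" and fT: "finite T"
      using T False less.prems(1) finite_subset by auto
    define M' where "M' = (\<Sum>i\<in>T. \<bar>h i\<bar>) / real k"
    have M': "M' \<ge> 0" unfolding M'_def by (simp add: sum_nonneg)
    have tail: "\<bar>h j\<bar> \<le> M'" if "j \<in> S - T" for j
      unfolding M'_def using tail_entry_le[OF cT] top that by blast
    have "card (S - T) < card S"
      using T cT k_pos False less.prems(1) fT by (simp add: card_Diff_subset)
    then have "N (S - T) \<le> C * (sqrt (real k) * M' + (\<Sum>i\<in>S - T. \<bar>h i\<bar>) / sqrt (real k))"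
      using less.hyps M' tail less.prems(1) by blast
    moreover have "N T \<le> C * (sqrt (real k) * M)"
      using bounded_max[of T M] less.prems T fT cT by auto
    moreover have "N S \<le> N T + N (S - T)"
      using subadd[of T "S - T"] less.prems(1) fT T(1) by (simp add: Un_absorb1)
    moreover have "sqrt (real k) * M' = (\<Sum>i\<in>T. \<bar>h i\<bar>) / sqrt (real k)"
      unfolding M'_def using k_pos by (simp add: field_simps)
    moreover have "(\<Sum>i\<in>S. \<bar>h i\<bar>) = (\<Sum>i\<in>S - T. \<bar>h i\<bar>) + (\<Sum>i\<in>T. \<bar>h i\<bar>)"
      using sum.subset_diff[OF T(1) less.prems(1)] .
    ultimately show ?thesis by (simp add: algebra_simps add_divide_distrib)
  qed
qed

text \<open>The mean over the removed block \<open>T\<close> serves as \<open>M\<close> in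
  \<open>sum_bound\<close>; the term \<open>sqrt (real k) * M\<close> is then exactly the share of
  \<open>T\<close> in the l1 sum over \<open>S\<close>.\<close>

lemma tail_bound:
  assumes "finite S" "T \<subseteq> S" "card T = min k (card S)"
    and top: "\<forall>i\<in>T. \<forall>j\<in>S - T. \<bar>h j\<bar> \<le> \<bar>h i\<bar>"
  shows "N (S - T) \<le> C * ((\<Sum>i\<in>S. \<bar>h i\<bar>) / sqrt (real k))"
proof (cases "card S \<le> k")
  case True
  then have "T = S" using assms by (simp add: card_subset_eq)
  moreover have "N {} \<le> 0" using bounded[of "{}"] by simp
  moreover have "C * ((\<Sum>i\<in>S. \<bar>h i\<bar>) / sqrt (real k)) \<ge> 0"
    using C_nonneg by (simp add: sum_nonneg)
  ultimately show ?thesis by simp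
next
  case False
  define M where "M = (\<Sum>i\<in>T. \<bar>h i\<bar>) / real k"
  have "card T = k" using assms(3) False by simp
  then have "\<bar>h j\<bar> \<le> M" if "j \<in> S - T" for j
    unfolding M_def using tail_entry_le top that by blast
  moreover have "M \<ge> 0" unfolding M_def by (simp add: sum_nonneg)
  ultimately have "N (S - T) \<le> C * (sqrt (real k) * M + (\<Sum>i\<in>S - T. \<bar>h i\<bar>) / sqrt (real k))"
    using sum_bound[of "S - T" M] assms(1) by blast
  moreover have "sqrt (real k) * M = (\<Sum>i\<in>T. \<bar>h i\<bar>) / sqrt (real k)"
    unfolding M_def using k_pos by (simp add: field_simps)
  moreover have "(\<Sum>i\<in>S. \<bar>h i\<bar>) = (\<Sum>i\<in>S - T. \<bar>h i\<bar>) + (\<Sum>i\<in>T. \<bar>h i\<bar>)"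
    using sum.subset_diff[OF assms(2,1)] .
  ultimately show ?thesis by (simp add: algebra_simps add_divide_distrib)
qed

end

section \<open>Restricted isometry and the cone inequality\<close>

lemma restricted_isometry_norm_bounds:
  assumes "restricted_isometry A k \<delta>" "card T \<le> k"
  shows "sqrt (1 - \<delta>) * L2_set x T \<le> norm (submatrix_mult A T x)"
    and "norm (submatrix_mult A T x) \<le> sqrt (1 + \<delta>) * L2_set x T"
proof -
  have *: "(1 - \<delta>) * (L2_set x T)\<^sup>2 \<le> (norm (submatrix_mult A T x))\<^sup>2"
    "(norm (submatrix_mult A T x))\<^sup>2 \<le> (1 + \<delta>) * (L2_set x T)\<^sup>2"
    using assms unfolding restricted_isometry_def by blast+
  show "sqrt (1 - \<delta>) * L2_set x T \<le> norm (submatrix_mult A T x)"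
    using real_sqrt_le_mono[OF *(1)] by (simp add: real_sqrt_mult)
  show "norm (submatrix_mult A T x) \<le> sqrt (1 + \<delta>) * L2_set x T"
    using real_sqrt_le_mono[OF *(2)] by (simp add: real_sqrt_mult)
qed

lemma submatrix_mult_union:
  assumes "S \<inter> T = {}"
  shows "submatrix_mult A (S \<union> T) x = submatrix_mult A S x + submatrix_mult A T x"
  unfolding submatrix_mult_def using assms by (intro sum.union_disjoint) auto

lemma submatrix_mult_UNIV: "submatrix_mult A UNIV (($) x) = A *v x"
  unfolding submatrix_mult_def by (simp add: matrix_mult_sum scalar_mult_eq_scaleR)

lemma norm_eq_L2_set_UNIV: "norm (x :: real ^ 'n) = L2_set (($) x) UNIV"
  unfolding norm_vec_def L2_set_def by simp

lemma springback_cone: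
  fixes x y :: "real ^ 'n"
  assumes "springback \<alpha> y \<le> springback \<alpha> x" "\<alpha> \<ge> 0" and S: "S = {i. x $ i \<noteq> 0}"
  shows "(\<Sum>i\<in>- S. \<bar>(y - x) $ i\<bar>) \<le> (\<Sum>i\<in>S. \<bar>(y - x) $ i\<bar>)
    + (\<alpha> * norm y * norm (y - x) - \<alpha> / 2 * (norm (y - x))\<^sup>2)"
proof -
  have split: "l1_norm z = (\<Sum>i\<in>S. \<bar>z $ i\<bar>) + (\<Sum>i\<in>- S. \<bar>z $ i\<bar>)" for z :: "real ^ 'n"
    unfolding l1_norm_def
    using sum.union_disjoint[of S "- S" "\<lambda>i. \<bar>z $ i\<bar>"] by simp
  have "(\<Sum>i\<in>S. \<bar>x $ i\<bar>) \<le> (\<Sum>i\<in>S. \<bar>y $ i\<bar> + \<bar>(y - x) $ i\<bar>)"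
    by (intro sum_mono) auto
  moreover have "(\<Sum>i\<in>- S. \<bar>x $ i\<bar>) = 0" "(\<Sum>i\<in>- S. \<bar>(y - x) $ i\<bar>) = (\<Sum>i\<in>- S. \<bar>y $ i\<bar>)"
    using S by (auto intro!: sum.neutral sum.cong)
  ultimately have "(\<Sum>i\<in>- S. \<bar>(y - x) $ i\<bar>) - (\<Sum>i\<in>S. \<bar>(y - x) $ i\<bar>) \<le> l1_norm y - l1_norm x"
    unfolding split by (simp add: sum.distrib)
  also have "\<dots> \<le> \<alpha> / 2 * ((norm y)\<^sup>2 - (norm x)\<^sup>2)"
    using assms(1) unfolding springback_def by (simp add: algebra_simps)
  \<comment> \<open>Expanding around \<open>y\<close> rather than \<open>x\<close> produces the
    negative square of \<open>norm (y - x)\<close>, the source of the final quadratic bound.\<close>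
  also have "(norm y)\<^sup>2 - (norm x)\<^sup>2 = 2 * (y \<bullet> (y - x)) - (norm (y - x))\<^sup>2"
    by (simp add: power2_norm_eq_inner inner_diff_left inner_diff_right inner_commute)
  also have "\<alpha> / 2 * (2 * (y \<bullet> (y - x)) - (norm (y - x))\<^sup>2)
      \<le> \<alpha> / 2 * (2 * (norm y * norm (y - x)) - (norm (y - x))\<^sup>2)"
    using assms(2) norm_cauchy_schwarz[of y "y - x"] by (intro mult_left_mono) auto
  finally show ?thesis by (simp add: algebra_simps)
qed

text \<open>The variables stand for \<open>a = sqrt (1 - \<delta>4s)\<close>, \<open>c = sqrt (1 + \<delta>3s)\<close>, \<open>p = sqrt (3s)\<close>,
  \<open>q = sqrt s\<close>, \<open>u = \<parallel>h\<parallel>\<close> on \<open>T0 \<union> T1\<close>, \<open>H = \<parallel>h\<parallel>\<close>, and \<open>R = \<parallel>h\<parallel>\<^sub>1\<close> off \<open>T0\<close>.\<close>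

lemma eliminate_head_norm:
  fixes a c p q u B H R t :: real
  assumes "a > 0" "c > 0" "p > 0" "q > 0" "a * p - c * q \<ge> 0"
    and R: "R \<le> q * u + B" and H: "H \<le> u + R / p" and t: "a * u \<le> 2 * t + c * (R / p)"
  shows "(a * p - c * q) * H - B * (a + c) \<le> 2 * t * (p + q)"
proof -
  have "p * H \<le> p * u + R" using H \<open>p > 0\<close> by (simp add: field_simps)
  then have H': "p * H - B \<le> (p + q) * u" using R by (simp add: algebra_simps)
  have "a * p * u \<le> 2 * t * p + c * R" using t \<open>p > 0\<close> by (simp add: field_simps)
  moreover have "c * R \<le> c * (q * u + B)" using R \<open>c > 0\<close> by simp
  ultimately have t': "(a * p - c * q) * u \<le> 2 * t * p + c * B" by (simp add: algebra_simps)
  have "(a * p - c * q) * (p * H - B) \<le> (a * p - c * q) * ((p + q) * u)"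
    using H' assms(5) by (rule mult_left_mono)
  also have "\<dots> = (p + q) * ((a * p - c * q) * u)" by simp
  also have "\<dots> \<le> (p + q) * (2 * t * p + c * B)"
    using t' assms by (intro mult_left_mono) auto
  finally have "p * ((a * p - c * q) * H - B * (a + c)) \<le> p * (2 * t * (p + q))"
    by (simp add: algebra_simps)
  then show ?thesis using \<open>p > 0\<close> by simp
qed

section \<open>The recovery bound\<close>

theorem theorem3p1:
  fixes s :: nat and A :: "real ^ 'n ^ 'm" and xbar xopt :: "real ^ 'n" and b e :: "real ^ 'm"
    and \<tau> \<alpha> \<delta>3s \<delta>4s D1 :: real
  assumes "s \<ge> 1"
    and "sparse_vec s xbar"
    and "\<tau> \<ge> 0"
    and "b = A *v xbar + e"
    and "norm e \<le> \<tau>"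
    and "is_RIC A (3 * s) \<delta>3s"
    and "is_RIC A (4 * s) \<delta>4s"
    and "\<alpha> > 0"
    and "is_arg_min (springback \<alpha>) (\<lambda>x. norm (A *v x - b) \<le> \<tau>) xopt"
    and "\<delta>3s < 3 * (1 - \<delta>4s) - 1"
    and "\<alpha> \<le> (sqrt (1 - \<delta>4s) * sqrt (3 * real s) - sqrt (1 + \<delta>3s) * sqrt (real s))
              / ((sqrt (1 - \<delta>4s) + sqrt (1 + \<delta>3s)) * norm xopt)"
    and "D1 = \<alpha> / 2 * ((sqrt (1 - \<delta>4s) + sqrt (1 + \<delta>3s)) / (sqrt (3 * real s) + sqrt (real s)))"
  shows "(\<tau> = 0 \<longrightarrow> xopt = xbar) \<and> norm (xopt - xbar) \<le> sqrt 2 / sqrt D1 * sqrt \<tau>"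
proof -
  define h where "h = xopt - xbar"
  define T0 where "T0 = {i. xbar $ i \<noteq> 0}"
  define a where "a = sqrt (1 - \<delta>4s)"
  define c where "c = sqrt (1 + \<delta>3s)"
  define p where "p = sqrt (3 * real s)"
  define q where "q = sqrt (real s)"
  define R where "R = (\<Sum>i\<in>- T0. \<bar>h $ i\<bar>)"
  define B where "B = \<alpha> * norm xopt * norm h - \<alpha> / 2 * (norm h)\<^sup>2"
  have ric3: "restricted_isometry A (3 * s) \<delta>3s" "0 < \<delta>3s" "\<delta>3s < 1"
    and ric4: "restricted_isometry A (4 * s) \<delta>4s" "0 < \<delta>4s" "\<delta>4s < 1"
    using assms(6,7) unfolding is_RIC_def by auto
  have pos: "a > 0" "c > 0" "p > 0" "q > 0"
    unfolding a_def c_def p_def q_def using ric3 ric4 assms(1) by auto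
  \<comment> \<open>If \<open>xopt = 0\<close>, the junk value of division by zero turns the bound into \<open>\<alpha> \<le> 0\<close>.\<close>
  have "norm xopt \<noteq> 0"
    using assms(8,11) by auto
  then have alpha: "\<alpha> * norm xopt * (a + c) \<le> a * p - c * q"
    using assms(11) pos unfolding a_def[symmetric] c_def[symmetric] p_def[symmetric] q_def[symmetric]
    by (simp add: pos_le_divide_eq mult_ac)
  have coeff: "a * p - c * q \<ge> 0"
    by (rule order_trans[OF _ alpha]) (use assms(8) pos in auto)
  \<comment> \<open>\<open>xbar\<close> is feasible because \<open>A *v xbar - b = - e\<close>, so
    its objective value can be compared with the minimum.\<close>
  have feas: "norm (A *v xopt - b) \<le> \<tau>" and
    "\<not> springback \<alpha> xbar < springback \<alpha> xopt"
    using assms(4,5,9) unfolding is_arg_min_def by auto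
  then have cone: "R \<le> (\<Sum>i\<in>T0. \<bar>h $ i\<bar>) + B"
    unfolding R_def B_def h_def using springback_cone[OF _ _ T0_def] assms(8) by auto
  have "A *v h = (A *v xopt - b) + e"
    unfolding h_def assms(4) by (simp add: matrix_vector_mult_diff_distrib)
  then have Ah: "norm (A *v h) \<le> 2 * \<tau>"
    using feas assms(5) norm_triangle_ineq[of "A *v xopt - b" e] by simp
  obtain T1 where T1: "T1 \<subseteq> - T0" "card T1 = min (3 * s) (card (- T0))"
    "\<forall>i\<in>T1. \<forall>j\<in>- T0 - T1. \<bar>h $ j\<bar> \<le> \<bar>h $ i\<bar>"
    using exists_top_subset[of "- T0" "3 * s" "\<lambda>i. \<bar>h $ i\<bar>"] by auto
  have card0: "card T0 \<le> s" using assms(2) unfolding sparse_vec_def T0_def .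
  have card01: "card (T0 \<union> T1) \<le> 4 * s"
    using card_Un_le[of T0 T1] card0 T1(2) by simp
  have compl: "(T0 \<union> T1) \<union> (- T0 - T1) = UNIV" "(T0 \<union> T1) \<inter> (- T0 - T1) = {}" by auto
  have k: "sqrt (real (3 * s)) = p" unfolding p_def by simp
  interpret L: block_bounded "L2_set (($) h)" "($) h" "3 * s" 1
    using assms(1) by unfold_locales (auto intro: L2_set_union_le)
  have L2tail: "L2_set (($) h) (- T0 - T1) \<le> R / p"
    using L.tail_bound[OF _ T1] unfolding R_def k by simp
  \<comment> \<open>The upper isometry bound at level \<open>3 * s\<close> supplies the block
    constant \<open>c\<close>.\<close>
  interpret M: block_bounded "\<lambda>T. norm (submatrix_mult A T (($) h))" "($) h" "3 * s" c
    using assms(1) pos restricted_isometry_norm_bounds(2)[OF ric3(1)]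
    by unfold_locales (auto simp: submatrix_mult_union norm_triangle_ineq c_def)
  have Atail: "norm (submatrix_mult A (- T0 - T1) (($) h)) \<le> c * (R / p)"
    using M.tail_bound[OF _ T1] unfolding R_def k by simp
  define u where "u = L2_set (($) h) (T0 \<union> T1)"
  have H: "norm h \<le> u + R / p"
    using L2_set_union_le[OF _ _ compl(2), of "($) h"] L2tail
    unfolding compl(1) norm_eq_L2_set_UNIV u_def by simp
  have "a * u \<le> norm (submatrix_mult A (T0 \<union> T1) (($) h))"
    unfolding a_def u_def by (rule restricted_isometry_norm_bounds(1)[OF ric4(1) card01])
  also have "submatrix_mult A (T0 \<union> T1) (($) h) = A *v h - submatrix_mult A (- T0 - T1) (($) h)"
    using submatrix_mult_union[OF compl(2), of A "($) h"] unfolding compl(1) submatrix_mult_UNIV by simp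
  also have "norm \<dots> \<le> 2 * \<tau> + c * (R / p)"
    using norm_triangle_ineq4[of "A *v h" "submatrix_mult A (- T0 - T1) (($) h)"] Ah Atail by simp
  finally have t: "a * u \<le> 2 * \<tau> + c * (R / p)" .
  have "(\<Sum>i\<in>T0. \<bar>h $ i\<bar>) \<le> q * L2_set (($) h) T0"
    unfolding q_def by (rule sum_abs_le_sqrt_mult_L2_set[OF card0])
  also have "L2_set (($) h) T0 \<le> u"
    unfolding u_def L2_set_def by (intro real_sqrt_le_mono sum_mono2) auto
  finally have R: "R \<le> q * u + B" using cone pos by simp
  have "(a * p - c * q) * norm h - B * (a + c) \<le> 2 * \<tau> * (p + q)"
    by (rule eliminate_head_norm[OF pos coeff R H t])
  \<comment> \<open>The term of \<open>B\<close> linear in \<open>norm h\<close> is absorbed by the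
    bound on \<alpha>; only its quadratic term survives.\<close>
  moreover have "\<alpha> * norm xopt * (a + c) * norm h \<le> (a * p - c * q) * norm h"
    using alpha by (rule mult_right_mono) simp
  ultimately have quad: "\<alpha> / 2 * (a + c) * (norm h)\<^sup>2 \<le> 2 * \<tau> * (p + q)"
    unfolding B_def by (simp add: algebra_simps add_divide_distrib)
  have D1: "D1 = \<alpha> / 2 * ((a + c) / (p + q))"
    unfolding assms(12) a_def c_def p_def q_def ..
  have "(a + c) / (p + q) * (p + q) = a + c" using pos by simp
  then have "\<alpha> / 2 * (a + c) = D1 * (p + q)"
    unfolding D1 by (simp only: mult.assoc)
  then have "D1 * (norm h)\<^sup>2 * (p + q) \<le> 2 * \<tau> * (p + q)"
    using quad by (simp only: mult_ac)
  then have "D1 * (norm h)\<^sup>2 \<le> 2 * \<tau>"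
    using pos by (simp only: mult_le_cancel_right_pos add_pos_pos)
  moreover have D1_pos: "D1 > 0" unfolding D1 using pos assms(8) by simp
  ultimately have main: "(norm h)\<^sup>2 \<le> 2 * \<tau> / D1" by (simp add: field_simps)
  have bound: "norm h \<le> sqrt 2 / sqrt D1 * sqrt \<tau>"
    using real_sqrt_le_mono[OF main] by (simp add: real_sqrt_mult real_sqrt_divide)
  \<comment> \<open>For \<tau> = 0 the bound is zero, which forces exact recovery.\<close>
  then show ?thesis unfolding h_def by auto
qed

end
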